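(* Consider the linear system $\dot{\mathbf{x}} = \mathbf{A}\mathbf{x} + \mathbf{B}\mathbf{u}$ with $\mathbf{A}\in\mathbb{R}^{n\times n}$, $\mathbf{B}\in\mathbb{R}^{n\times m}$, and affine constraint functions $h_i(\mathbf{x}) = \mathbf{c}_i^\top\mathbf{x}+d_i$, $i\in[\bar p]$, where $h_i$ has relative degree $r_i\geq 1$, together with constants $\alpha_{i,j}>0$ ($i\in[\bar p]$, $j\in[r_i]$). Let $\boldsymbol{\ell}_i = \mathbf{B}^\top(\mathbf{A}^{r_i-1})^\top\mathbf{c}_i\in\mathbb{R}^m$, and assume that, for some $p\leq\bar p$, the vectors $\{\boldsymbol{\ell}_i\}_{i=1}^{p}$ are linearly independent and the vectors $\{\boldsymbol{\ell}_i\}_{i=p+1}^{\bar p}$ are linear combinations of $\{\boldsymbol{\ell}_i\}_{i=1}^{p}$. Then there exists $\mathbf{K}\in\mathbb{R}^{m\times n}$ such that $\mathbf{u}=-\mathbf{K}\mathbf{x}$ satisfies all $\bar p$ HOCBF constraints for all $\mathbf{x}\in\mathbb{R}^n$, i.e. $$\mathbf{c}_i^\top\boldsymbol{\Phi}_i(\mathbf{A})\mathbf{x} - \boldsymbol{\ell}_i^\top\mathbf{K}\mathbf{x} + \alpha_i d_i\geq 0\qquad \text{for all } i\in[\bar p],\ \mathbf{x}\in\mathbb{R}^n,$$ if and only if $d_i\geq 0$ for all $i\in[\bar p]$ and $$\mathbf{c}_i^\top\boldsymbol{\Phi}_i(\mathbf{A})-\boldsymbol{\ell}_i^\top\mathbf{K}_0=\mathbf{0}_n^\top\qquad\text{for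 all } i\in[\bar p]\setminus[p].$$ In that case, the set of all such matrices is $$\{\mathbf{K}\in\mathbb{R}^{m\times n} : \mathbf{K} = \mathbf{K}_0 + \mathbf{L}_\perp\tilde{\mathbf{K}},\ \tilde{\mathbf{K}}\in\mathbb{R}^{(m-p)\times n}\}.$$
   Context: $[k]=\{1,\dots,k\}$. For the linear system, $h_i(\mathbf{x})=\mathbf{c}_i^\top\mathbf{x}+d_i$ (with $\mathbf{c}_i\in\mathbb{R}^n$, $d_i\in\mathbb{R}$) has relative degree $r_i\in\mathbb{Z}_{>0}$ if $\mathbf{c}_i^\top\mathbf{A}^{r_i-1}\mathbf{B}\neq\mathbf{0}$ and $\mathbf{c}_i^\top\mathbf{A}^{k}\mathbf{B}=\mathbf{0}$ for all $0\le k<r_i-1$. Set $\boldsymbol{\Phi}_i(\mathbf{A})=\prod_{l=1}^{r_i}(\mathbf{A}+\alpha_{i,l}\mathbf{I}_n)$ and $\alpha_i=\prod_{j=1}^{r_i}\alpha_{i,j}$. The $i$-th HOCBF (high-order control barrier function) constraint on a pair $(\mathbf{x},\mathbf{u})$ is $\mathbf{c}_i^\top\boldsymbol{\Phi}_i(\mathbf{A})\mathbf{x}+\mathbf{c}_i^\top\mathbf{A}^{r_i-1}\mathbf{B}\mathbf{u}+\alpha_i d_i\geq 0$. $\mathbf{L}\in\mathbb{R}^{m\times p}$ is the matrix with columns $\boldsymbol{\ell}_1,\dots,\boldsymbol{\ell}_p$; $\mathbf{L}_\perp\in\mathbb{R}^{m\times(m-p)}$ is a matrix whose columns form a basis of $\ker(\mathbf{L}^\top)$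 (if $m=p$ the term $\mathbf{L}_\perp\tilde{\mathbf{K}}$ is zero); $\tilde{\mathbf{C}}\in\mathbb{R}^{p\times n}$ is the matrix whose $i$-th row is $\mathbf{c}_i^\top\boldsymbol{\Phi}_i(\mathbf{A})$, $i\in[p]$; and $\mathbf{K}_0=\mathbf{L}(\mathbf{L}^\top\mathbf{L})^{-1}\tilde{\mathbf{C}}$. *)

theory Defs
  imports
    "Jordan_Normal_Form.Matrix_Kernel"
    "Jordan_Normal_Form.Gauss_Jordan_Elimination"
begin

text \<open>
  Vectors and matrices are those of the Jordan normal form library, so all dimensions
  (including \<open>m - p\<close>, which may be \<open>0\<close>) are natural numbers.
  A row vector \<open>v\<^sup>T M\<close> is represented by the vector \<open>M\<^sup>T v\<close>.
\<close>

definition has_relative_degree :: "real mat \<Rightarrow> real mat \<Rightarrow> real vec \<Rightarrow> nat \<Rightarrow> bool" where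
  "has_relative_degree A B c r \<longleftrightarrow>
     r > 0 \<and>
     transpose_mat (A ^\<^sub>m (r - 1) * B) *\<^sub>v c \<noteq> 0\<^sub>v (dim_col B) \<and>
     (\<forall>k < r - 1. transpose_mat (A ^\<^sub>m k * B) *\<^sub>v c = 0\<^sub>v (dim_col B))"

definition input_vector :: "real mat \<Rightarrow> real mat \<Rightarrow> real vec \<Rightarrow> nat \<Rightarrow> real vec" where
  "input_vector A B c r = transpose_mat B *\<^sub>v (transpose_mat (A ^\<^sub>m (r - 1)) *\<^sub>v c)"

text \<open>The factors of the product are polynomials in \<open>A\<close>, so their order is immaterial.\<close>

definition Phi :: "real mat \<Rightarrow> (nat \<Rightarrow> real) \<Rightarrow> nat \<Rightarrow> real mat" where
  "Phi A a r =
     foldr (\<lambda>l M. (A + a l \<cdot>\<^sub>m 1\<^sub>m (dim_row A)) * M) [1..<Suc r] (1\<^sub>m (dim_row A))"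

definition Phi_row :: "real mat \<Rightarrow> real vec \<Rightarrow> (nat \<Rightarrow> real) \<Rightarrow> nat \<Rightarrow> real vec" where
  "Phi_row A c a r = transpose_mat (Phi A a r) *\<^sub>v c"

definition hocbf_constraint ::
  "real mat \<Rightarrow> real mat \<Rightarrow> real vec \<Rightarrow> real \<Rightarrow> nat \<Rightarrow> (nat \<Rightarrow> real) \<Rightarrow> real vec \<Rightarrow> real vec \<Rightarrow> bool"
where
  "hocbf_constraint A B c d r a x u \<longleftrightarrow>
     Phi_row A c a r \<bullet> x + (transpose_mat (A ^\<^sub>m (r - 1) * B) *\<^sub>v c) \<bullet> u + (\<Prod>j = 1..r. a j) * d \<ge> 0"

definition L_mat :: "nat \<Rightarrow> nat \<Rightarrow> (nat \<Rightarrow> real vec) \<Rightarrow> real mat" where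
  "L_mat m p l = mat_of_cols m (map l [1..<Suc p])"

definition C_tilde ::
  "nat \<Rightarrow> nat \<Rightarrow> real mat \<Rightarrow> (nat \<Rightarrow> real vec) \<Rightarrow> (nat \<Rightarrow> nat \<Rightarrow> real) \<Rightarrow> (nat \<Rightarrow> nat) \<Rightarrow> real mat" where
  "C_tilde n p A c \<alpha> r = mat_of_rows n (map (\<lambda>i. Phi_row A (c i) (\<alpha> i) (r i)) [1..<Suc p])"

text \<open>Meaningful when the columns of \<open>L\<close> are linearly independent, so that
  \<open>L\<^sup>T L\<close> is invertible.\<close>

definition K_zero :: "real mat \<Rightarrow> real mat \<Rightarrow> real mat" where
  "K_zero L Ct = L * the (mat_inverse (transpose_mat L * L)) * Ct"

abbreviation lin_indpt_family :: "nat \<Rightarrow> (nat \<Rightarrow> real vec) \<Rightarrow> nat set \<Rightarrow> bool" where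
  "lin_indpt_family m l I \<equiv>
     inj_on l I \<and> \<not> module.lin_dep class_ring (module_vec TYPE(real) m) (l ` I)"

abbreviation vec_span :: "nat \<Rightarrow> real vec set \<Rightarrow> real vec set" where
  "vec_span m S \<equiv> LinearCombinations.module.span class_ring (module_vec TYPE(real) m) S"

text \<open>The columns of \<open>N\<close>, without repetition, form a basis of the kernel of \<open>M\<close>.\<close>

definition kernel_basis_mat :: "real mat \<Rightarrow> real mat \<Rightarrow> bool" where
  "kernel_basis_mat M N \<longleftrightarrow>
     dim_row N = dim_col M \<and> distinct (cols N) \<and> kernel.basis (dim_col M) M (set (cols N))"

lemma hocbf_constraint_feedback:
  assumes A: "A \<in> carrier_mat n n" and B: "B \<in> carrier_mat n m" and c: "c \<in> carrier_vec n"
    and K: "K \<in> carrier_mat m n" and x: "x \<in> carrier_vec n"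
  shows "hocbf_constraint A B c d r a x (- (K *\<^sub>v x)) \<longleftrightarrow>
    Phi_row A c a r \<bullet> x - input_vector A B c r \<bullet> (K *\<^sub>v x) + (\<Prod>j = 1..r. a j) * d \<ge> 0"
proof -
  have P: "A ^\<^sub>m (r - 1) \<in> carrier_mat n n" using A by simp
  have "transpose_mat (A ^\<^sub>m (r - 1) * B) *\<^sub>v c = input_vector A B c r"
    unfolding input_vector_def transpose_mult[OF P B]
    by (rule assoc_mult_mat_vec) (use B P c in auto)
  moreover have "input_vector A B c r \<in> carrier_vec m"
    unfolding input_vector_def using B by (intro carrier_vecI) simp
  ultimately show ?thesis
    using K x by (simp add: hocbf_constraint_def)
qed

end

theory Submission
  imports Defs "Jordan_Normal_Form.DL_Rank"
begin

text \<open>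
  An affine function that is nonnegative on all of \<open>\<real>\<^sup>n\<close> has zero linear part. Under the feedback
  \<open>u = - K x\<close> every constraint is affine in \<open>x\<close>, so feasibility of \<open>K\<close> splits into the sign
  conditions \<open>d\<^sub>i \<ge> 0\<close> (because the products \<open>\<alpha>\<^sub>i\<close> are positive) and the linear equations
  \<open>K\<^sup>T \<ell>\<^sub>i = \<Phi>\<^sub>i(A)\<^sup>T c\<^sub>i\<close> (lemma \<open>feedback_feasible_iff\<close>).

  The equations with \<open>i \<le> p\<close> together say \<open>L\<^sup>T K = C\<close>, where \<open>C\<close> is the matrix of the right-hand
  sides. Linear independence of \<open>\<ell>\<^sub>1, \<dots>, \<ell>\<^sub>p\<close> makes \<open>L\<^sup>T L\<close> invertible, so \<open>K\<^sub>0\<close> is a particular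
  solution (lemma \<open>K_zero_right_inverse\<close>), and the others differ from it by a matrix whose columns
  lie in the kernel of \<open>L\<^sup>T\<close>, that is, by some \<open>L\<^sub>\<bottom> K'\<close> (lemma \<open>kernel_basis_mat_factor_iff\<close>).

  For \<open>i > p\<close> we have \<open>\<ell>\<^sub>i = L w\<close>, hence \<open>K\<^sup>T \<ell>\<^sub>i = (L\<^sup>T K)\<^sup>T w\<close>. This vector is the same for all
  solutions \<open>K\<close> of \<open>L\<^sup>T K = C\<close>, so the remaining equations hold for all of these solutions or for
  none, and it suffices to test them at \<open>K\<^sub>0\<close>.
\<close>

section \<open>Affine constraints under linear feedback\<close>

lemma affine_nonneg_iff:
  fixes a :: "real vec" and b :: real
  assumes a: "a \<in> carrier_vec n"
  shows "(\<forall>x \<in> carrier_vec n. a \<bullet> x + b \<ge> 0) \<longleftrightarrow> a = 0\<^sub>v n \<and> b \<ge> 0"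
proof
  assume nonneg: "\<forall>x \<in> carrier_vec n. a \<bullet> x + b \<ge> 0"
  have b: "b \<ge> 0" using nonneg[rule_format, of "0\<^sub>v n"] a by simp
  have "a \<bullet> a = 0"
  proof (rule ccontr)
    assume nz: "a \<bullet> a \<noteq> 0"
    \<comment> \<open>Far enough along the direction \<open>- a\<close> the function takes the value \<open>- 1\<close>.\<close>
    have "a \<bullet> ((- (b + 1) / (a \<bullet> a)) \<cdot>\<^sub>v a) + b = - 1"
      using a nz by simp
    moreover have "a \<bullet> ((- (b + 1) / (a \<bullet> a)) \<cdot>\<^sub>v a) + b \<ge> 0"
      by (rule nonneg[rule_format]) (use a in simp)
    ultimately show False by simp
  qed
  then have "a = 0\<^sub>v n" using conjugate_square_eq_0_vec[OF a] by simp
  with b show "a = 0\<^sub>v n \<and> b \<ge> 0" by simp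
qed auto

lemma minus_vec_zero_iff:
  fixes v w :: "'a :: group_add vec"
  assumes "v \<in> carrier_vec n" "w \<in> carrier_vec n"
  shows "v - w = 0\<^sub>v n \<longleftrightarrow> v = w"
  using assms by (auto simp: vec_eq_iff)

lemma Phi_row_carrier:
  assumes A: "A \<in> carrier_mat n n"
  shows "Phi_row A c a r \<in> carrier_vec n"
proof -
  have "foldr (\<lambda>l M. (A + a l \<cdot>\<^sub>m 1\<^sub>m (dim_row A)) * M) ls (1\<^sub>m (dim_row A)) \<in> carrier_mat n n" for ls
    using A by (induction ls) auto
  then have "Phi A a r \<in> carrier_mat n n" unfolding Phi_def .
  then show ?thesis unfolding Phi_row_def by (intro carrier_vecI) simp
qed

lemma input_vector_carrier:
  assumes "B \<in> carrier_mat n m"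
  shows "input_vector A B c r \<in> carrier_vec m"
  unfolding input_vector_def using assms by (intro carrier_vecI) simp

lemma feedback_feasible_iff:
  assumes A: "A \<in> carrier_mat n n" and B: "B \<in> carrier_mat n m" and c: "c \<in> carrier_vec n"
    and K: "K \<in> carrier_mat m n" and pos: "\<And>j. j \<in> {1..r} \<Longrightarrow> a j > 0"
  shows "(\<forall>x \<in> carrier_vec n. hocbf_constraint A B c d r a x (- (K *\<^sub>v x))) \<longleftrightarrow>
    transpose_mat K *\<^sub>v input_vector A B c r = Phi_row A c a r \<and> d \<ge> 0"
proof -
  let ?l = "input_vector A B c r" and ?f = "Phi_row A c a r"
  have l: "?l \<in> carrier_vec m" using B by (rule input_vector_carrier)
  have f: "?f \<in> carrier_vec n" using A by (rule Phi_row_carrier)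
  have g: "transpose_mat K *\<^sub>v ?l \<in> carrier_vec n" using K l by simp
  have alpha: "(\<Prod>j = 1..r. a j) > 0" using pos by (intro prod_pos) auto
  have "hocbf_constraint A B c d r a x (- (K *\<^sub>v x)) \<longleftrightarrow>
      (?f - transpose_mat K *\<^sub>v ?l) \<bullet> x + (\<Prod>j = 1..r. a j) * d \<ge> 0"
    if x: "x \<in> carrier_vec n" for x
  proof -
    have "?l \<bullet> (K *\<^sub>v x) = (transpose_mat K *\<^sub>v ?l) \<bullet> x"
      using transpose_vec_mult_scalar[OF K x l] by simp
    then show ?thesis
      using hocbf_constraint_feedback[OF A B c K x] minus_scalar_prod_distrib[OF f g x] by simp
  qed
  then have "(\<forall>x \<in> carrier_vec n. hocbf_constraint A B c d r a x (- (K *\<^sub>v x))) \<longleftrightarrow>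
      ?f - transpose_mat K *\<^sub>v ?l = 0\<^sub>v n \<and> (\<Prod>j = 1..r. a j) * d \<ge> 0"
    using affine_nonneg_iff[of "?f - transpose_mat K *\<^sub>v ?l" n] f g by simp
  moreover have "?f - transpose_mat K *\<^sub>v ?l = 0\<^sub>v n \<longleftrightarrow> transpose_mat K *\<^sub>v ?l = ?f"
    using minus_vec_zero_iff[OF f g] by auto
  ultimately show ?thesis using alpha by (simp add: zero_le_mult_iff)
qed

section \<open>The matrix of independent input vectors\<close>

lemma L_mat_carrier: "L_mat m p l \<in> carrier_mat m p"
  unfolding L_mat_def using mat_of_cols_carrier(1)[of m "map l [1..<Suc p]"] by (simp del: upt_Suc)

lemma L_mat_inj:
  fixes l :: "nat \<Rightarrow> real vec"
  assumes l: "\<And>i. l i \<in> carrier_vec m" and indep: "lin_indpt_family m l {1..p}"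
    and v: "v \<in> carrier_vec p" and Lv: "L_mat m p l *\<^sub>v v = 0\<^sub>v m"
  shows "v = 0\<^sub>v p"
proof (rule ccontr)
  assume nz: "v \<noteq> 0\<^sub>v p"
  interpret vec_space "TYPE(real)" m .
  have L: "L_mat m p l \<in> carrier_mat m p"
    by (rule L_mat_carrier)
  have cols: "cols (L_mat m p l) = map l [1..<Suc p]"
    unfolding L_mat_def using l by (intro cols_mat_of_cols) auto
  have "{1..<Suc p} = {1..p}" by auto
  then have set: "set (cols (L_mat m p l)) = l ` {1..p}" and dist: "distinct (cols (L_mat m p l))"
    using indep unfolding cols by (simp_all add: distinct_map del: upt_Suc)
  have "lin_dep (set (cols (L_mat m p l)))" by (rule lin_depI[OF L v nz Lv dist])
  with conjunct2[OF indep] show False unfolding set by (rule notE)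
qed

lemma in_span_imp_L_mat_mult:
  fixes l :: "nat \<Rightarrow> real vec"
  assumes l: "\<And>i. l i \<in> carrier_vec m" and b: "b \<in> vec_span m (l ` {1..p})"
  obtains w where "w \<in> carrier_vec p" "b = L_mat m p l *\<^sub>v w"
proof -
  interpret vec_space "TYPE(real)" m .
  have set: "set (map l [1..<Suc p]) = l ` {1..p}"
    by (simp only: set_map set_upt atLeastLessThanSuc_atLeastAtMost)
  have "set (map l [1..<Suc p]) \<subseteq> carrier_vec m" using l unfolding set by blast
  then have "b \<in> span_list (map l [1..<Suc p])"
    using b by (simp only: span_list_as_span set)
  then obtain f where "b = lincomb_list f (map l [1..<Suc p])"
    by (rule in_span_listE)
  also have "\<dots> = L_mat m p l *\<^sub>v vec p f"
    unfolding L_mat_def using l carrier_vecD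
    by (subst lincomb_list_as_mat_mult) (auto simp del: upt_Suc)
  finally show thesis by (intro that[of "vec p f"]) auto
qed

text \<open>If \<open>L\<^sup>T L v = 0\<close>, then \<open>\<bar>L v\<bar>\<^sup>2 = v\<^sup>T L\<^sup>T L v = 0\<close>, so injectivity of \<open>L\<close> gives invertibility of
  the Gram matrix \<open>L\<^sup>T L\<close>.\<close>

lemma K_zero_right_inverse:
  fixes L C :: "real mat"
  assumes L: "L \<in> carrier_mat m p" and C: "C \<in> carrier_mat p n"
    and inj: "\<And>v. v \<in> carrier_vec p \<Longrightarrow> L *\<^sub>v v = 0\<^sub>v m \<Longrightarrow> v = 0\<^sub>v p"
  shows "K_zero L C \<in> carrier_mat m n" "transpose_mat L * K_zero L C = C"
proof -
  let ?G = "transpose_mat L * L"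
  have LT: "transpose_mat L \<in> carrier_mat p m" using L by simp
  have G: "?G \<in> carrier_mat p p" using L by simp
  have "v = 0\<^sub>v p" if v: "v \<in> carrier_vec p" and Gv: "?G *\<^sub>v v = 0\<^sub>v p" for v
  proof -
    have Lv: "L *\<^sub>v v \<in> carrier_vec m" using L v by simp
    have "(L *\<^sub>v v) \<bullet> (L *\<^sub>v v) = (transpose_mat L *\<^sub>v (L *\<^sub>v v)) \<bullet> v"
      using transpose_vec_mult_scalar[OF L v Lv] by simp
    also have "transpose_mat L *\<^sub>v (L *\<^sub>v v) = 0\<^sub>v p"
      using Gv assoc_mult_mat_vec[OF LT L v] by simp
    finally have "L *\<^sub>v v = 0\<^sub>v m"
      using conjugate_square_eq_0_vec[OF Lv] v by simp
    then show ?thesis using inj v by blast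
  qed
  then have "det ?G \<noteq> 0" using det_0_iff_vec_prod_zero[OF G] by blast
  then have "?G \<in> Units (ring_mat TYPE(real) p ())" by (rule det_non_zero_imp_unit[OF G])
  then obtain H where H: "mat_inverse ?G = Some H"
    using mat_inverse(1)[OF G, of "()"] by (cases "mat_inverse ?G") auto
  then have GH: "?G * H = 1\<^sub>m p" and Hc: "H \<in> carrier_mat p p"
    using mat_inverse(2)[OF G] by auto
  have K0: "K_zero L C = L * (H * C)"
    unfolding K_zero_def H using assoc_mult_mat[OF L Hc C] by simp
  show "K_zero L C \<in> carrier_mat m n" unfolding K0 using L Hc C by simp
  have HC: "H * C \<in> carrier_mat p n" using Hc C by simp
  have "transpose_mat L * (L * (H * C)) = ?G * (H * C)"
    using assoc_mult_mat[OF LT L HC] by simp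
  also have "\<dots> = ?G * H * C" using assoc_mult_mat[OF G Hc C] by simp
  finally show "transpose_mat L * K_zero L C = C" unfolding K0 GH using C by simp
qed

section \<open>Solution sets of linear matrix equations\<close>

lemma mat_minus_eq_iff:
  fixes X Y Z :: "'a :: ab_group_add mat"
  assumes "X \<in> carrier_mat a b" "Y \<in> carrier_mat a b" "Z \<in> carrier_mat a b"
  shows "X - Y = Z \<longleftrightarrow> X = Y + Z"
  using assms by (auto simp: mat_eq_iff algebra_simps)

text \<open>The basis property refers to spans inside the kernel, taken as a vector space of its own; these
  agree with the spans in the ambient space, which are the ranges of matrices.\<close>

lemma kernel_basis_mat_vec_iff:
  assumes M: "M \<in> carrier_mat q m" and N: "N \<in> carrier_mat m k"
    and basis: "kernel_basis_mat M N" and v: "v \<in> carrier_vec m"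
  shows "M *\<^sub>v v = 0\<^sub>v q \<longleftrightarrow> (\<exists>w \<in> carrier_vec k. v = N *\<^sub>v w)"
proof -
  interpret kernel q m M by unfold_locales (rule M)
  have dist: "distinct (cols N)" and "kernel.basis m M (set (cols N))"
    using basis M unfolding kernel_basis_mat_def by auto
  then have sub: "set (cols N) \<subseteq> mat_kernel M" and gen: "span (set (cols N)) = mat_kernel M"
    unfolding Ker.basis_def by auto
  have carr: "set (cols N) \<subseteq> carrier_vec m" using N cols_dim by blast
  have "M *\<^sub>v v = 0\<^sub>v q \<longleftrightarrow> v \<in> NC.span (set (cols N))"
    using v mat_kernel[OF M] gen span_same[OF sub] by auto
  also have "\<dots> \<longleftrightarrow> (\<exists>w \<in> carrier_vec k. v = N *\<^sub>v w)"
  proof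
    assume "v \<in> NC.span (set (cols N))"
    then obtain f where "v = NC.lincomb f (set (cols N))"
      using NC.finite_span[OF _ carr] by auto
    then show "\<exists>w \<in> carrier_vec k. v = N *\<^sub>v w"
      using NC.mat_mult_eq_lincomb[OF N dist, of f] by (intro bexI[of _ "vec k (\<lambda>i. f (col N i))"]) auto
  next
    assume "\<exists>w \<in> carrier_vec k. v = N *\<^sub>v w"
    then obtain w where w: "w \<in> carrier_vec k" "v = N *\<^sub>v w" by blast
    then have "v = NC.lincomb (\<lambda>a. w $ find_first a (cols N)) (set (cols N))"
      using NC.lincomb_eq_mat_mult[OF N w(1) dist] by simp
    then show "v \<in> NC.span (set (cols N))" by (rule NC.in_spanI) auto
  qed
  finally show ?thesis .
qed

lemma kernel_basis_mat_factor_iff: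
  assumes M: "M \<in> carrier_mat q m" and N: "N \<in> carrier_mat m k"
    and basis: "kernel_basis_mat M N" and D: "D \<in> carrier_mat m n"
  shows "M * D = 0\<^sub>m q n \<longleftrightarrow> (\<exists>E \<in> carrier_mat k n. D = N * E)"
proof
  assume MD: "M * D = 0\<^sub>m q n"
  have "\<exists>w \<in> carrier_vec k. col D j = N *\<^sub>v w" if j: "j < n" for j
  proof -
    have "M *\<^sub>v col D j = col (M * D) j" using col_mult2[OF M D j] by simp
    then have "M *\<^sub>v col D j = 0\<^sub>v q" unfolding MD using j by simp
    then show ?thesis using kernel_basis_mat_vec_iff[OF M N basis] D j by auto
  qed
  then obtain w where w: "\<And>j. j < n \<Longrightarrow> w j \<in> carrier_vec k \<and> col D j = N *\<^sub>v w j" by metis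
  define E where "E = mat_of_cols k (map w [0..<n])"
  have E: "E \<in> carrier_mat k n"
    unfolding E_def using mat_of_cols_carrier(1)[of k "map w [0..<n]"] by simp
  have "D = N * E"
  proof (rule mat_col_eqI)
    fix j assume "j < dim_col (N * E)"
    then have j: "j < n" using E by simp
    have "col E j = w j" unfolding E_def using j w by (subst col_mat_of_cols) auto
    then show "col D j = col (N * E) j" using col_mult2[OF N E j] w[OF j] by simp
  qed (use N D E in auto)
  with E show "\<exists>E \<in> carrier_mat k n. D = N * E" by blast
next
  assume "\<exists>E \<in> carrier_mat k n. D = N * E"
  then obtain E where E: "E \<in> carrier_mat k n" and DE: "D = N * E" by blast
  show "M * D = 0\<^sub>m q n"
  proof (rule mat_col_eqI)
    fix j assume "j < dim_col (0\<^sub>m q n)"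
    then have j: "j < n" by simp
    have "col (M * D) j = M *\<^sub>v (N *\<^sub>v col E j)"
      using col_mult2[OF M D j] col_mult2[OF N E j] DE by simp
    also have "\<dots> = 0\<^sub>v q"
      using kernel_basis_mat_vec_iff[OF M N basis, of "N *\<^sub>v col E j"] N E j by auto
    finally show "col (M * D) j = col (0\<^sub>m q n) j" using j by simp
  qed (use M D in auto)
qed

text \<open>Row \<open>i\<close> of the equation \<open>L\<^sup>T K = C\<close> is the equation for \<open>K\<^sup>T \<ell>\<^sub>i\<close>.\<close>

lemma L_mat_transpose_mult_eq_iff:
  fixes l f :: "nat \<Rightarrow> real vec"
  assumes l: "\<And>i. l i \<in> carrier_vec m" and f: "\<And>i. f i \<in> carrier_vec n"
    and K: "K \<in> carrier_mat m n"
  shows "transpose_mat (L_mat m p l) * K = mat_of_rows n (map f [1..<Suc p]) \<longleftrightarrow>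
    (\<forall>i \<in> {1..p}. transpose_mat K *\<^sub>v l i = f i)"
proof -
  let ?L = "L_mat m p l" and ?C = "mat_of_rows n (map f [1..<Suc p])"
  have L: "?L \<in> carrier_mat m p"
    by (rule L_mat_carrier)
  have C: "?C \<in> carrier_mat p n"
    using mat_of_rows_carrier(1)[of n "map f [1..<Suc p]"] by (simp del: upt_Suc)
  have rowC: "row ?C i = f (Suc i)" if "i < p" for i
    using that f by (subst mat_of_rows_row) (auto simp del: upt_Suc)
  have colL: "col ?L i = l (Suc i)" if "i < p" for i
    unfolding L_mat_def using that l by (subst col_mat_of_cols) (auto simp del: upt_Suc)
  have rowLK: "row (transpose_mat ?L * K) i = transpose_mat K *\<^sub>v l (Suc i)" if i: "i < p" for i
  proof -
    have "row (transpose_mat ?L * K) i = col (transpose_mat (transpose_mat ?L * K)) i"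
      using i L by simp
    also have "\<dots> = col (transpose_mat K * ?L) i"
      using transpose_mult[of "transpose_mat ?L" p m K n] L K by simp
    also have "\<dots> = transpose_mat K *\<^sub>v l (Suc i)"
      using col_mult2[of "transpose_mat K" n m ?L p i] L K i colL by simp
    finally show ?thesis .
  qed
  have "transpose_mat ?L * K = ?C \<longleftrightarrow> (\<forall>i < p. row (transpose_mat ?L * K) i = row ?C i)"
    using L K C eq_rowI[of ?C "transpose_mat ?L * K"] by (auto simp del: upt_Suc row_mult)
  also have "\<dots> \<longleftrightarrow> (\<forall>i < p. transpose_mat K *\<^sub>v l (Suc i) = f (Suc i))"
    using rowC rowLK by simp
  also have "\<dots> \<longleftrightarrow> (\<forall>i \<in> {1..p}. transpose_mat K *\<^sub>v l i = f i)"
    by (metis One_nat_def Suc_le_D Suc_le_eq atLeastAtMost_iff le_add1 plus_1_eq_Suc)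
  finally show ?thesis .
qed

text \<open>On the range of \<open>L\<close>, the map \<open>K\<^sup>T\<close> depends only on \<open>L\<^sup>T K\<close>.\<close>

lemma transpose_mult_range_cong:
  fixes L K K' :: "real mat"
  assumes L: "L \<in> carrier_mat m p" and K: "K \<in> carrier_mat m n" and K': "K' \<in> carrier_mat m n"
    and eq: "transpose_mat L * K = transpose_mat L * K'" and w: "w \<in> carrier_vec p"
  shows "transpose_mat K *\<^sub>v (L *\<^sub>v w) = transpose_mat K' *\<^sub>v (L *\<^sub>v w)"
proof -
  have "transpose_mat J *\<^sub>v (L *\<^sub>v w) = transpose_mat (transpose_mat L * J) *\<^sub>v w"
    if J: "J \<in> carrier_mat m n" for J
    using transpose_mult[of "transpose_mat L" p m J n] assoc_mult_mat_vec[of "transpose_mat J" n m L p w]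
      L J w by simp
  then show ?thesis using K K' eq by simp
qed

section \<open>Feasible feedback gains\<close>

theorem proposition3:
  fixes n m p pbar :: nat
    and A B :: "real mat"
    and c :: "nat \<Rightarrow> real vec" and d :: "nat \<Rightarrow> real"
    and r :: "nat \<Rightarrow> nat" and \<alpha> :: "nat \<Rightarrow> nat \<Rightarrow> real"
    and ell :: "nat \<Rightarrow> real vec" and L K\<^sub>0 :: "real mat"
    and feasible :: "real mat \<Rightarrow> bool" and conditions :: bool
  defines "ell \<equiv> \<lambda>i. input_vector A B (c i) (r i)"
    and "L \<equiv> L_mat m p ell"
    and "K\<^sub>0 \<equiv> K_zero L (C_tilde n p A c \<alpha> r)"
    and "feasible \<equiv> \<lambda>K. \<forall>i \<in> {1..pbar}. \<forall>x \<in> carrier_vec n.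
      hocbf_constraint A B (c i) (d i) (r i) (\<alpha> i) x (- (K *\<^sub>v x))"
    and "conditions \<equiv> (\<forall>i \<in> {1..pbar}. d i \<ge> 0) \<and>
      (\<forall>i \<in> {1..pbar} - {1..p}.
         Phi_row A (c i) (\<alpha> i) (r i) - transpose_mat K\<^sub>0 *\<^sub>v ell i = 0\<^sub>v n)"
  assumes A: "A \<in> carrier_mat n n" and B: "B \<in> carrier_mat n m"
    and c: "\<And>i. i \<in> {1..pbar} \<Longrightarrow> c i \<in> carrier_vec n"
    and rel_degree: "\<And>i. i \<in> {1..pbar} \<Longrightarrow> has_relative_degree A B (c i) (r i)"
    and alpha_pos: "\<And>i j. i \<in> {1..pbar} \<Longrightarrow> j \<in> {1..r i} \<Longrightarrow> \<alpha> i j > 0"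
    and p: "p \<le> pbar"
    and indep: "lin_indpt_family m ell {1..p}"
    and dep: "\<And>i. i \<in> {p+1..pbar} \<Longrightarrow> ell i \<in> vec_span m (ell ` {1..p})"
  shows "((\<exists>K \<in> carrier_mat m n. feasible K) \<longleftrightarrow> conditions) \<and>
    (conditions \<longrightarrow>
      (\<forall>L_perp \<in> carrier_mat m (m - p). kernel_basis_mat (transpose_mat L) L_perp \<longrightarrow>
        {K \<in> carrier_mat m n. feasible K} =
        {K \<in> carrier_mat m n. \<exists>K_til \<in> carrier_mat (m - p) n. K = K\<^sub>0 + L_perp * K_til}))"
proof -
  let ?f = "\<lambda>i. Phi_row A (c i) (\<alpha> i) (r i)"
  have l: "ell i \<in> carrier_vec m" for i
    unfolding ell_def using B by (rule input_vector_carrier)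
  have f: "?f i \<in> carrier_vec n" for i
    using A by (rule Phi_row_carrier)
  have L: "L \<in> carrier_mat m p"
    unfolding L_def by (rule L_mat_carrier)
  have LT: "transpose_mat L \<in> carrier_mat p m" using L by simp
  have C: "C_tilde n p A c \<alpha> r \<in> carrier_mat p n"
    unfolding C_tilde_def using mat_of_rows_carrier(1)[of n "map ?f [1..<Suc p]"] by (simp del: upt_Suc)
  have inj: "v = 0\<^sub>v p" if "v \<in> carrier_vec p" "L *\<^sub>v v = 0\<^sub>v m" for v
    using L_mat_inj[OF l indep that(1)] that(2) unfolding L_def by simp
  have K0: "K\<^sub>0 \<in> carrier_mat m n" and LK0: "transpose_mat L * K\<^sub>0 = C_tilde n p A c \<alpha> r"
    unfolding K\<^sub>0_def by (rule K_zero_right_inverse[OF L C], erule (1) inj)+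
  have first_iff: "transpose_mat L * K = C_tilde n p A c \<alpha> r \<longleftrightarrow>
      (\<forall>i \<in> {1..p}. transpose_mat K *\<^sub>v ell i = ?f i)" if "K \<in> carrier_mat m n" for K
    unfolding L_def C_tilde_def by (rule L_mat_transpose_mult_eq_iff[OF l f that])
  have rest_cong: "transpose_mat K *\<^sub>v ell i = transpose_mat K\<^sub>0 *\<^sub>v ell i"
    if K: "K \<in> carrier_mat m n" and LK: "transpose_mat L * K = C_tilde n p A c \<alpha> r"
      and i: "i \<in> {p+1..pbar}" for K i
  proof -
    obtain w where "w \<in> carrier_vec p" "ell i = L *\<^sub>v w"
      unfolding L_def by (rule in_span_imp_L_mat_mult[OF l dep[OF i]])
    then show ?thesis
      using transpose_mult_range_cong[OF L K K0] LK LK0 by simp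
  qed
  have split: "{1..pbar} = {1..p} \<union> {p+1..pbar}" "{1..pbar} - {1..p} = {p+1..pbar}"
    using p by auto
  have conditions_iff: "conditions \<longleftrightarrow> (\<forall>i \<in> {1..pbar}. d i \<ge> 0) \<and>
      (\<forall>i \<in> {p+1..pbar}. transpose_mat K\<^sub>0 *\<^sub>v ell i = ?f i)"
  proof -
    have "?f i - transpose_mat K\<^sub>0 *\<^sub>v ell i = 0\<^sub>v n \<longleftrightarrow> transpose_mat K\<^sub>0 *\<^sub>v ell i = ?f i" for i
      using minus_vec_zero_iff[OF f, of "transpose_mat K\<^sub>0 *\<^sub>v ell i" i] K0 l[of i] by auto
    then show ?thesis unfolding conditions_def split(2) by simp
  qed
  have feasible_iff: "feasible K \<longleftrightarrow> transpose_mat L * K = C_tilde n p A c \<alpha> r \<and> conditions"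
    if K: "K \<in> carrier_mat m n" for K
  proof -
    have "feasible K \<longleftrightarrow> (\<forall>i \<in> {1..pbar}. transpose_mat K *\<^sub>v ell i = ?f i \<and> d i \<ge> 0)"
      unfolding feasible_def ell_def
    proof (intro ball_cong refl)
      fix i assume i: "i \<in> {1..pbar}"
      show "(\<forall>x \<in> carrier_vec n.
            hocbf_constraint A B (c i) (d i) (r i) (\<alpha> i) x (- (K *\<^sub>v x))) \<longleftrightarrow>
          transpose_mat K *\<^sub>v input_vector A B (c i) (r i) = ?f i \<and> d i \<ge> 0"
        by (rule feedback_feasible_iff[OF A B c[OF i] K alpha_pos[OF i]])
    qed
    also have "\<dots> \<longleftrightarrow> (\<forall>i \<in> {1..p}. transpose_mat K *\<^sub>v ell i = ?f i) \<and>
        (\<forall>i \<in> {p+1..pbar}. transpose_mat K *\<^sub>v ell i = ?f i) \<and> (\<forall>i \<in> {1..pbar}. d i \<ge> 0)"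
      unfolding split(1) by blast
    also have "\<dots> \<longleftrightarrow> transpose_mat L * K = C_tilde n p A c \<alpha> r \<and> conditions"
      unfolding first_iff[OF K, symmetric] conditions_iff using rest_cong[OF K] by auto
    finally show ?thesis .
  qed
  have "(\<exists>K \<in> carrier_mat m n. feasible K) \<longleftrightarrow> conditions"
    using feasible_iff K0 LK0 by blast
  moreover have "{K \<in> carrier_mat m n. feasible K} =
      {K \<in> carrier_mat m n. \<exists>K_til \<in> carrier_mat (m - p) n. K = K\<^sub>0 + L_perp * K_til}"
    if conditions and N: "L_perp \<in> carrier_mat m (m - p)"
      and basis: "kernel_basis_mat (transpose_mat L) L_perp" for L_perp
  proof -
    have "feasible K \<longleftrightarrow> (\<exists>K_til \<in> carrier_mat (m - p) n. K = K\<^sub>0 + L_perp * K_til)"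
      if K: "K \<in> carrier_mat m n" for K
    proof -
      have D: "K - K\<^sub>0 \<in> carrier_mat m n" using K0 by (rule minus_carrier_mat)
      have "feasible K \<longleftrightarrow> transpose_mat L * K = transpose_mat L * K\<^sub>0"
        using feasible_iff[OF K] \<open>conditions\<close> LK0 by simp
      also have "\<dots> \<longleftrightarrow> transpose_mat L * (K - K\<^sub>0) = 0\<^sub>m p n"
        unfolding mult_minus_distrib_mat[OF LT K K0]
        using mat_minus_eq_iff[of "transpose_mat L * K" p n "transpose_mat L * K\<^sub>0" "0\<^sub>m p n"] LT K K0 by simp
      also have "\<dots> \<longleftrightarrow> (\<exists>K_til \<in> carrier_mat (m - p) n. K - K\<^sub>0 = L_perp * K_til)"
        by (rule kernel_basis_mat_factor_iff[OF LT N basis D])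
      also have "\<dots> \<longleftrightarrow> (\<exists>K_til \<in> carrier_mat (m - p) n. K = K\<^sub>0 + L_perp * K_til)"
        using mat_minus_eq_iff[OF K K0] N by (intro bex_cong) auto
      finally show ?thesis .
    qed
    then show ?thesis by blast
  qed
  ultimately show ?thesis by blast
qed

end
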